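(* Let $\kappa$ be a field, $G$ an infinite group having a non-trivial element of finite order, and $\sigma\in pm(G)$ an idempotent factor set, i.e. $\sigma(g,h)\in\{0,1\}$ for all $g,h\in G$. Let $\xi\in\Omega$. Then $\xi\notin\Omega_\sigma$ if, and only if, $\xi$ contains a $\sigma$-prohibition of type I.
   Context: A partial projective $\sigma$-representation of $G$ in a unital (associative) $\kappa$-algebra $R$ (with $1_R\neq 0$) is a map $\Gamma:G\to R$ for which there is a function $\sigma:G\times G\to\kappa$ (called the factor set) such that for all $g,h\in G$: (i) if $\sigma(g,h)=0$ then $\Gamma(g^{-1})\Gamma(gh)=0$ and $\Gamma(gh)\Gamma(h^{-1})=0$; (ii) if $\Gamma(g)\Gamma(h)=0$ then $\sigma(g,h)=0$; (iii) $\Gamma(1_G)=1_R$; (iv) $\Gamma(g^{-1})\Gamma(g)\Gamma(h)=\sigma(g,h)\Gamma(g^{-1})\Gamma(gh)$; (v) $\Gamma(g)\Gamma(h)\Gamma(h^{-1})=\sigma(g,h)\Gamma(gh)\Gamma(h^{-1})$. The set of all factor sets of $G$ (over all such $R$ and $\Gamma$) is $pm(G)$. Let $\Omega=\{\xi\subseteq G:1\in\xi\}$. The $\sigma$-prohibitions of type I are the sets $\{h,hg,hgs\}$ with $h,g,s\in G$ and $\sigma(g,s)=0$; those of type II are the sets $\{h,hg,hgs,hgst\}$ with $h,g,s,t\in G$ and $\sigma(g,st)\sigma(s,t)\neq\sigma(g,s)\sigma(gs,t)$. $\mathcal{P}_\sigma$ is the set of all $\sigma$-prohibitions (of both types), and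 $\Omega_\sigma=\{\xi\in\Omega: V\nsubseteq\xi\text{ for all }V\in\mathcal{P}_\sigma\}$. *)

theory Defs
  imports "HOL-Algebra.Algebra"
begin

text \<open>The library locale \<^locale>\<open>algebra\<close> requires a commutative multiplication; the
  algebras in which partial projective representations take their values need not be commutative.\<close>

locale unital_algebra = module K R + K?: field K + A?: ring R
  for K (structure) and R (structure) +
  assumes one_not_zero: "\<one>\<^bsub>R\<^esub> \<noteq> \<zero>\<^bsub>R\<^esub>"
    and smult_mult_left:
      "\<lbrakk>a \<in> carrier K; x \<in> carrier R; y \<in> carrier R\<rbrakk> \<Longrightarrow>
        (a \<odot>\<^bsub>R\<^esub> x) \<otimes>\<^bsub>R\<^esub> y = a \<odot>\<^bsub>R\<^esub> (x \<otimes>\<^bsub>R\<^esub> y)"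
    and smult_mult_right:
      "\<lbrakk>a \<in> carrier K; x \<in> carrier R; y \<in> carrier R\<rbrakk> \<Longrightarrow>
        x \<otimes>\<^bsub>R\<^esub> (a \<odot>\<^bsub>R\<^esub> y) = a \<odot>\<^bsub>R\<^esub> (x \<otimes>\<^bsub>R\<^esub> y)"

definition partial_projective_rep ::
  "('g, 'm) monoid_scheme \<Rightarrow> ('k, 'n) ring_scheme \<Rightarrow> ('k, 'r, 'p) module_scheme \<Rightarrow>
    ('g \<Rightarrow> 'g \<Rightarrow> 'k) \<Rightarrow> ('g \<Rightarrow> 'r) \<Rightarrow> bool"
  where "partial_projective_rep G K R \<sigma> \<Gamma> \<longleftrightarrow>
    \<Gamma> \<in> carrier G \<rightarrow> carrier R \<and>
    \<sigma> \<in> carrier G \<rightarrow> carrier G \<rightarrow> carrier K \<and>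
    \<Gamma> \<one>\<^bsub>G\<^esub> = \<one>\<^bsub>R\<^esub> \<and>
    (\<forall>g \<in> carrier G. \<forall>h \<in> carrier G.
      (\<sigma> g h = \<zero>\<^bsub>K\<^esub> \<longrightarrow>
        \<Gamma> (inv\<^bsub>G\<^esub> g) \<otimes>\<^bsub>R\<^esub> \<Gamma> (g \<otimes>\<^bsub>G\<^esub> h) = \<zero>\<^bsub>R\<^esub> \<and>
        \<Gamma> (g \<otimes>\<^bsub>G\<^esub> h) \<otimes>\<^bsub>R\<^esub> \<Gamma> (inv\<^bsub>G\<^esub> h) = \<zero>\<^bsub>R\<^esub>) \<and>
      (\<Gamma> g \<otimes>\<^bsub>R\<^esub> \<Gamma> h = \<zero>\<^bsub>R\<^esub> \<longrightarrow> \<sigma> g h = \<zero>\<^bsub>K\<^esub>) \<and>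
      \<Gamma> (inv\<^bsub>G\<^esub> g) \<otimes>\<^bsub>R\<^esub> \<Gamma> g \<otimes>\<^bsub>R\<^esub> \<Gamma> h =
        \<sigma> g h \<odot>\<^bsub>R\<^esub> (\<Gamma> (inv\<^bsub>G\<^esub> g) \<otimes>\<^bsub>R\<^esub> \<Gamma> (g \<otimes>\<^bsub>G\<^esub> h)) \<and>
      \<Gamma> g \<otimes>\<^bsub>R\<^esub> \<Gamma> h \<otimes>\<^bsub>R\<^esub> \<Gamma> (inv\<^bsub>G\<^esub> h) =
        \<sigma> g h \<odot>\<^bsub>R\<^esub> (\<Gamma> (g \<otimes>\<^bsub>G\<^esub> h) \<otimes>\<^bsub>R\<^esub> \<Gamma> (inv\<^bsub>G\<^esub> h)))"

text \<open>HOL cannot quantify over types inside a definition, so the type \<open>'r\<close> of the elements of the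
  algebra is a parameter. A theorem assuming \<open>\<sigma> \<in> pm TYPE('r) G K\<close> for an arbitrary type \<open>'r\<close>
  covers every algebra.\<close>

definition pm ::
  "'r itself \<Rightarrow> ('g, 'm) monoid_scheme \<Rightarrow> ('k, 'n) ring_scheme \<Rightarrow> ('g \<Rightarrow> 'g \<Rightarrow> 'k) set"
  where "pm (_ :: 'r itself) G K =
    {\<sigma>. \<exists>(R :: ('k, 'r) module) \<Gamma>.
      unital_algebra K R \<and> partial_projective_rep G K R \<sigma> \<Gamma>}"

definition Omega :: "('g, 'm) monoid_scheme \<Rightarrow> 'g set set"
  where "Omega G = {\<xi>. \<xi> \<subseteq> carrier G \<and> \<one>\<^bsub>G\<^esub> \<in> \<xi>}"

definition prohibitions_I ::
  "('g, 'm) monoid_scheme \<Rightarrow> ('k, 'n) ring_scheme \<Rightarrow> ('g \<Rightarrow> 'g \<Rightarrow> 'k) \<Rightarrow> 'g set set"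
  where "prohibitions_I G K \<sigma> =
    {{h, h \<otimes>\<^bsub>G\<^esub> g, h \<otimes>\<^bsub>G\<^esub> g \<otimes>\<^bsub>G\<^esub> s} | h g s.
      h \<in> carrier G \<and> g \<in> carrier G \<and> s \<in> carrier G \<and> \<sigma> g s = \<zero>\<^bsub>K\<^esub>}"

definition prohibitions_II ::
  "('g, 'm) monoid_scheme \<Rightarrow> ('k, 'n) ring_scheme \<Rightarrow> ('g \<Rightarrow> 'g \<Rightarrow> 'k) \<Rightarrow> 'g set set"
  where "prohibitions_II G K \<sigma> =
    {{h, h \<otimes>\<^bsub>G\<^esub> g, h \<otimes>\<^bsub>G\<^esub> g \<otimes>\<^bsub>G\<^esub> s, h \<otimes>\<^bsub>G\<^esub> g \<otimes>\<^bsub>G\<^esub> s \<otimes>\<^bsub>G\<^esub> t} | h g s t.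
      h \<in> carrier G \<and> g \<in> carrier G \<and> s \<in> carrier G \<and> t \<in> carrier G \<and>
      \<sigma> g (s \<otimes>\<^bsub>G\<^esub> t) \<otimes>\<^bsub>K\<^esub> \<sigma> s t \<noteq> \<sigma> g s \<otimes>\<^bsub>K\<^esub> \<sigma> (g \<otimes>\<^bsub>G\<^esub> s) t}"

definition prohibitions ::
  "('g, 'm) monoid_scheme \<Rightarrow> ('k, 'n) ring_scheme \<Rightarrow> ('g \<Rightarrow> 'g \<Rightarrow> 'k) \<Rightarrow> 'g set set"
  where "prohibitions G K \<sigma> = prohibitions_I G K \<sigma> \<union> prohibitions_II G K \<sigma>"

definition Omega_sigma ::
  "('g, 'm) monoid_scheme \<Rightarrow> ('k, 'n) ring_scheme \<Rightarrow> ('g \<Rightarrow> 'g \<Rightarrow> 'k) \<Rightarrow> 'g set set"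
  where "Omega_sigma G K \<sigma> =
    {\<xi> \<in> Omega G. \<forall>V \<in> prohibitions G K \<sigma>. \<not> V \<subseteq> \<xi>}"

end

theory Submission
  imports Defs
begin

lemma prohibitions_I_I:
  assumes "h \<in> carrier G" "g \<in> carrier G" "s \<in> carrier G" "\<sigma> g s = \<zero>\<^bsub>K\<^esub>"
  shows "{h, h \<otimes>\<^bsub>G\<^esub> g, h \<otimes>\<^bsub>G\<^esub> g \<otimes>\<^bsub>G\<^esub> s} \<in> prohibitions_I G K \<sigma>"
  using assms unfolding prohibitions_I_def by blast

text \<open>If the cocycle identity fails for an idempotent \<open>\<sigma>\<close>, then one of the four values in it is
  \<open>\<zero>\<close>, and each of them belongs to a triple contained in the quadruple.\<close>

lemma prohibitions_II_contains_I:
  assumes "group G"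
    and idem: "\<And>g h. \<lbrakk>g \<in> carrier G; h \<in> carrier G\<rbrakk> \<Longrightarrow> \<sigma> g h \<in> {\<zero>\<^bsub>K\<^esub>, \<one>\<^bsub>K\<^esub>}"
    and V: "V \<in> prohibitions_II G K \<sigma>"
  shows "\<exists>W \<in> prohibitions_I G K \<sigma>. W \<subseteq> V"
proof -
  interpret group G by fact
  obtain h g s t where
    V_eq: "V = {h, h \<otimes>\<^bsub>G\<^esub> g, h \<otimes>\<^bsub>G\<^esub> g \<otimes>\<^bsub>G\<^esub> s, h \<otimes>\<^bsub>G\<^esub> g \<otimes>\<^bsub>G\<^esub> s \<otimes>\<^bsub>G\<^esub> t}"
    and mem [simp]: "h \<in> carrier G" "g \<in> carrier G" "s \<in> carrier G" "t \<in> carrier G"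
    and neq: "\<sigma> g (s \<otimes>\<^bsub>G\<^esub> t) \<otimes>\<^bsub>K\<^esub> \<sigma> s t \<noteq> \<sigma> g s \<otimes>\<^bsub>K\<^esub> \<sigma> (g \<otimes>\<^bsub>G\<^esub> s) t"
    using V unfolding prohibitions_II_def by blast
  have "\<sigma> g (s \<otimes>\<^bsub>G\<^esub> t) \<in> {\<zero>\<^bsub>K\<^esub>, \<one>\<^bsub>K\<^esub>}" "\<sigma> s t \<in> {\<zero>\<^bsub>K\<^esub>, \<one>\<^bsub>K\<^esub>}"
    "\<sigma> g s \<in> {\<zero>\<^bsub>K\<^esub>, \<one>\<^bsub>K\<^esub>}" "\<sigma> (g \<otimes>\<^bsub>G\<^esub> s) t \<in> {\<zero>\<^bsub>K\<^esub>, \<one>\<^bsub>K\<^esub>}"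
    by (simp_all only: idem mem m_closed)
  with neq consider "\<sigma> g (s \<otimes>\<^bsub>G\<^esub> t) = \<zero>\<^bsub>K\<^esub>" | "\<sigma> s t = \<zero>\<^bsub>K\<^esub>" | "\<sigma> g s = \<zero>\<^bsub>K\<^esub>"
    | "\<sigma> (g \<otimes>\<^bsub>G\<^esub> s) t = \<zero>\<^bsub>K\<^esub>"
    by auto
  then show ?thesis
  proof cases
    case 1
    \<comment> \<open>Going from hg straight to hgst in one step s t gives a triple that skips the
      third point hgs; associativity matches its end with the last point of
      \<open>V\<close>.\<close>
    then show ?thesis
      by (intro bexI [OF _ prohibitions_I_I [of h G g "s \<otimes>\<^bsub>G\<^esub> t"]]) (auto simp: V_eq m_assoc)
  next
    case 2
    \<comment> \<open>Here the first point h is dropped: the triple is translated so as to start at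
      hg, and its steps are s and t.\<close>
    then show ?thesis
      by (intro bexI [OF _ prohibitions_I_I [of "h \<otimes>\<^bsub>G\<^esub> g" G s t]]) (auto simp: V_eq m_assoc)
  next
    case 3
    \<comment> \<open>The first three points of \<open>V\<close> already form the triple.\<close>
    then show ?thesis
      by (intro bexI [OF _ prohibitions_I_I [of h G g s]]) (auto simp: V_eq m_assoc)
  next
    case 4
    \<comment> \<open>Merging the first two steps into gs skips the second point hg.\<close>
    then show ?thesis
      by (intro bexI [OF _ prohibitions_I_I [of h G "g \<otimes>\<^bsub>G\<^esub> s" t]]) (auto simp: V_eq m_assoc)
  qed
qed

theorem lemma9p1:
  fixes G :: "('g, 'm) monoid_scheme"
    and K :: "('k, 'n) ring_scheme"
    and \<sigma> :: "'g \<Rightarrow> 'g \<Rightarrow> 'k"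
    and \<xi> :: "'g set"
  assumes "field K"
    and "group G"
    and "infinite (carrier G)"
    and "\<exists>x \<in> carrier G. x \<noteq> \<one>\<^bsub>G\<^esub> \<and> group.ord G x \<noteq> 0"
    and "\<sigma> \<in> pm TYPE('r) G K"
    and "\<forall>g \<in> carrier G. \<forall>h \<in> carrier G. \<sigma> g h \<in> {\<zero>\<^bsub>K\<^esub>, \<one>\<^bsub>K\<^esub>}"
    and "\<xi> \<in> Omega G"
  shows "\<xi> \<notin> Omega_sigma G K \<sigma> \<longleftrightarrow> (\<exists>V \<in> prohibitions_I G K \<sigma>. V \<subseteq> \<xi>)"
proof
  assume "\<xi> \<notin> Omega_sigma G K \<sigma>"
  \<comment> \<open>Since \<open>\<xi>\<close> lies in \<open>Omega G\<close>, only a prohibition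
    inside \<open>\<xi>\<close> can exclude it from \<open>Omega_sigma G K \<sigma>\<close>.\<close>
  then obtain V where "V \<in> prohibitions G K \<sigma>" "V \<subseteq> \<xi>"
    using assms(7) unfolding Omega_sigma_def by blast
  \<comment> \<open>If \<open>V\<close> is of type II, a type I set inside \<open>V\<close> lies in
    \<open>\<xi>\<close> by transitivity of inclusion; if \<open>V\<close> is of type I, it serves
    itself.\<close>
  moreover have "\<exists>W \<in> prohibitions_I G K \<sigma>. W \<subseteq> V" if "V \<in> prohibitions_II G K \<sigma>"
    using assms(2) _ that by (rule prohibitions_II_contains_I) (use assms(6) in blast)
  ultimately show "\<exists>V \<in> prohibitions_I G K \<sigma>. V \<subseteq> \<xi>"
    unfolding prohibitions_def by blast
next
  assume "\<exists>V \<in> prohibitions_I G K \<sigma>. V \<subseteq> \<xi>"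
  \<comment> \<open>A type I set is itself one of the prohibitions that a member of
    \<open>Omega_sigma G K \<sigma>\<close> must not contain.\<close>
  then show "\<xi> \<notin> Omega_sigma G K \<sigma>"
    unfolding Omega_sigma_def prohibitions_def by blast
qed

end
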